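(* Let $s \geq 1$ be an integer and, for $n \geq 0$, let $f(n)$ denote the number of linear extensions of the uneven type-$\alpha$ comb $\alpha^{\ast}_{s}(n)$ that avoid both patterns $231$ and $312$. Then $$f(n) = \begin{cases} 1 & \text{if } n \leq s,\\ 2^{n-s} & \text{if } s < n < 2s,\\ 2f(n-1) - f(n-s-1) & \text{if } n \geq 2s.\end{cases}$$
   Context: A linear extension of a finite poset $P$ on a set of integers is a listing $v=[v_1,\dots,v_n]$ of all elements of $P$, each exactly once, such that whenever $a \leq_P b$, $a$ appears before $b$. For $w \in S_3$, a sequence $v$ of distinct integers contains $w$ if there are indices $i<j<k$ with $(v_i,v_j,v_k)$ in the same relative order as $(w_1,w_2,w_3)$; otherwise $v$ avoids $w$. The uneven type-$\alpha$ comb $\alpha^{\ast}_{s}(n)$ with $s$ teeth and $n$ elements is the poset on $\{1,\dots,n\}$ whose order is generated by the relations $i \leq i+1$ for $1 \leq i < \min(s,n)$ (the spine) and $x \leq x+s$ for $1 \leq x \leq n-s$ (the teeth $c, c+s, c+2s, \dots$ for $1 \le c \le s$, truncated at $n$). When $n = ts$, this is the type-$\alpha$ comb with $s$ teeth of length $t$. *)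

theory Defs
  imports Main
begin

definition is_linear_extension :: "'a set \<Rightarrow> ('a \<times> 'a) set \<Rightarrow> 'a list \<Rightarrow> bool" where
  "is_linear_extension A r v \<longleftrightarrow>
     distinct v \<and> set v = A \<and>
     (\<forall>i < length v. \<forall>j < length v. (v ! i, v ! j) \<in> r \<longrightarrow> i \<le> j)"

definition same_relative_order :: "'a::linorder list \<Rightarrow> 'b::linorder list \<Rightarrow> bool" where
  "same_relative_order xs ys \<longleftrightarrow>
     length xs = length ys \<and>
     (\<forall>a < length xs. \<forall>b < length xs. xs ! a < xs ! b \<longleftrightarrow> ys ! a < ys ! b)"

(* A pattern w in S_3 is given in one-line notation, e.g. 231 is [2,3,1].
   Positions in v are counted from 0. *)
definition contains_pattern :: "'a::linorder list \<Rightarrow> nat list \<Rightarrow> bool" where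
  "contains_pattern v w \<longleftrightarrow>
     (\<exists>i j k. i < j \<and> j < k \<and> k < length v \<and> same_relative_order [v ! i, v ! j, v ! k] w)"

definition avoids_pattern :: "'a::linorder list \<Rightarrow> nat list \<Rightarrow> bool" where
  "avoids_pattern v w \<longleftrightarrow> \<not> contains_pattern v w"

(* The bound x <= n - s on the teeth is written x + s <= n, which avoids
   truncated subtraction. *)
definition comb_generators :: "nat \<Rightarrow> nat \<Rightarrow> (nat \<times> nat) set" where
  "comb_generators s n =
     {(i, i + 1) | i. 1 \<le> i \<and> i < min s n} \<union>
     {(x, x + s) | x. 1 \<le> x \<and> x + s \<le> n}"

(* The reflexive closure is taken over the whole type nat, so the relation has
   to be cut down to the ground set {1..n}. *)
definition comb_order :: "nat \<Rightarrow> nat \<Rightarrow> (nat \<times> nat) set" where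
  "comb_order s n = (comb_generators s n)\<^sup>* \<inter> ({1..n} \<times> {1..n})"

definition comb_extensions_avoiding :: "nat \<Rightarrow> nat \<Rightarrow> nat list set" where
  "comb_extensions_avoiding s n =
     {v. is_linear_extension {1..n} (comb_order s n) v \<and>
         avoids_pattern v [2, 3, 1] \<and> avoids_pattern v [3, 1, 2]}"

definition num_comb_extensions_avoiding :: "nat \<Rightarrow> nat \<Rightarrow> nat" where
  "num_comb_extensions_avoiding s n = card (comb_extensions_avoiding s n)"

lemma comb_generators_rtrancl_le:
  assumes "s \<ge> 1" "(a, b) \<in> (comb_generators s n)\<^sup>*"
  shows "a \<le> b"
  using assms(2) by (induction rule: rtrancl_induct) (auto simp: comb_generators_def)

lemma partial_order_on_comb_order:
  assumes "s \<ge> 1"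
  shows "partial_order_on {1..n} (comb_order s n)"
  unfolding partial_order_on_def preorder_on_def
proof (intro conjI)
  show "refl_on {1..n} (comb_order s n)"
    by (auto simp: refl_on_def comb_order_def)
  show "trans (comb_order s n)"
    by (rule transI) (auto simp: comb_order_def intro: rtrancl_trans)
  show "antisym (comb_order s n)"
    by (rule antisymI)
       (auto simp: comb_order_def intro: antisym comb_generators_rtrancl_le[OF assms])
qed (auto simp: comb_order_def)

(* Hence card counts this set and is not the default value 0. *)
lemma finite_comb_extensions_avoiding: "finite (comb_extensions_avoiding s n)"
proof (rule finite_subset)
  show "comb_extensions_avoiding s n \<subseteq> {v. set v \<subseteq> {1..n} \<and> length v = n}"
    by (auto simp: comb_extensions_avoiding_def is_linear_extension_def distinct_card[symmetric])
  show "finite {v. set v \<subseteq> {1..n} \<and> length v = n}"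
    by (rule finite_lists_length_eq) simp
qed

end

theory Submission
  imports Defs
begin

text \<open>
  A permutation avoiding 231 and 312 is layered: everything after its maximum \<open>n\<close> decreases
  (no 312) and exceeds everything before \<open>n\<close> (no 231), so it ends in \<open>n, n - 1, \<dots>, m + 1\<close>,
  preceded by a permutation of \<open>{1..m}\<close> of the same kind. It is a linear extension of the comb iff
  each layer is an antichain, which for the last layer means that \<open>m = n - 1\<close>, or that
  \<open>n - m \<le> s\<close> and \<open>m + 1 \<ge> s\<close>. Hence \<open>f n\<close> is the sum of \<open>f m\<close> over these \<open>m\<close>,
  and for \<open>n \<ge> 2 s\<close> comparing the sums for \<open>n\<close> and \<open>n - 1\<close> gives the recurrence.
\<close>

section \<open>Pattern avoidance\<close>

lemma same_relative_order_231:
  fixes a b c :: "'a::linorder"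
  shows "same_relative_order [a, b, c] [2::nat, 3, 1] \<longleftrightarrow> c < a \<and> a < b"
  by (auto simp: same_relative_order_def less_Suc_eq numeral_3_eq_3 all_conj_distrib imp_conjL
      intro: less_trans)

lemma same_relative_order_312:
  fixes a b c :: "'a::linorder"
  shows "same_relative_order [a, b, c] [3::nat, 1, 2] \<longleftrightarrow> b < c \<and> c < a"
  by (auto simp: same_relative_order_def less_Suc_eq numeral_3_eq_3 all_conj_distrib imp_conjL
      intro: less_trans)

lemma avoids_pattern_231_iff:
  "avoids_pattern v [2, 3, 1] \<longleftrightarrow>
    (\<forall>i j k. i < j \<longrightarrow> j < k \<longrightarrow> k < length v \<longrightarrow> \<not> (v ! k < v ! i \<and> v ! i < v ! j))"
  unfolding avoids_pattern_def contains_pattern_def same_relative_order_231 by blast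

lemma avoids_pattern_312_iff:
  "avoids_pattern v [3, 1, 2] \<longleftrightarrow>
    (\<forall>i j k. i < j \<longrightarrow> j < k \<longrightarrow> k < length v \<longrightarrow> \<not> (v ! j < v ! k \<and> v ! k < v ! i))"
  unfolding avoids_pattern_def contains_pattern_def same_relative_order_312 by blast

lemma avoids_pattern_appendD: "avoids_pattern (u @ w) p \<Longrightarrow> avoids_pattern u p"
proof (unfold avoids_pattern_def, erule contrapos_nn)
  assume "contains_pattern u p"
  then obtain i j k where "i < j" "j < k" "k < length u" "same_relative_order [u ! i, u ! j, u ! k] p"
    by (auto simp: contains_pattern_def)
  then show "contains_pattern (u @ w) p"
    unfolding contains_pattern_def
    by (intro exI[of _ i] exI[of _ j] exI[of _ k]) (simp add: nth_append)
qed

text \<open>Both patterns contain an ascent and end in a letter smaller than their first. An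
  occurrence whose last entry lies in \<open>w\<close> therefore starts in \<open>w\<close> as well,
  because \<open>u\<close> lies below \<open>w\<close>; but \<open>w\<close> has no ascent. So every
  occurrence already lies in \<open>u\<close>.\<close>

lemma avoids_pattern_append_layer:
  fixes u w :: "'a::linorder list"
  assumes less: "\<forall>x\<in>set u. \<forall>y\<in>set w. x < y"
    and decr: "sorted_wrt (>) w"
  shows "avoids_pattern (u @ w) [2, 3, 1] \<longleftrightarrow> avoids_pattern u [2, 3, 1]"
    and "avoids_pattern (u @ w) [3, 1, 2] \<longleftrightarrow> avoids_pattern u [3, 1, 2]"
proof -
  let ?v = "u @ w"
  have cross: "?v ! i < ?v ! j" if "i < length u" "length u \<le> j" "j < length ?v" for i j
    using that less by (simp add: nth_append)
  have desc: "?v ! j < ?v ! i" if "length u \<le> i" "i < j" "j < length ?v" for i j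
    using that decr by (simp add: nth_append sorted_wrt_iff_nth_less)
  have inner: "?v ! i = u ! i" if "i < length u" for i
    using that by (simp add: nth_append)
  show "avoids_pattern ?v [2, 3, 1] \<longleftrightarrow> avoids_pattern u [2, 3, 1]"
  proof
    assume u: "avoids_pattern u [2, 3, 1]"
    show "avoids_pattern ?v [2, 3, 1]"
      unfolding avoids_pattern_231_iff
    proof (intro allI impI notI)
      fix i j k assume ijk: "i < j" "j < k" "k < length ?v"
        and *: "?v ! k < ?v ! i \<and> ?v ! i < ?v ! j"
      show False
      proof (cases "k < length u")
        case True
        then show False using u ijk * inner unfolding avoids_pattern_231_iff
          by (metis less_trans)
      next
        case False
        then show False using ijk * cross[of i k] desc[of i j] by fastforce
      qed
    qed
  qed (rule avoids_pattern_appendD)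
  show "avoids_pattern ?v [3, 1, 2] \<longleftrightarrow> avoids_pattern u [3, 1, 2]"
  proof
    assume u: "avoids_pattern u [3, 1, 2]"
    show "avoids_pattern ?v [3, 1, 2]"
      unfolding avoids_pattern_312_iff
    proof (intro allI impI notI)
      fix i j k assume ijk: "i < j" "j < k" "k < length ?v"
        and *: "?v ! j < ?v ! k \<and> ?v ! k < ?v ! i"
      show False
      proof (cases "k < length u")
        case True
        then show False using u ijk * inner unfolding avoids_pattern_312_iff
          by (metis less_trans)
      next
        case False
        then show False using ijk * cross[of i k] desc[of j k] by fastforce
      qed
    qed
  qed (rule avoids_pattern_appendD)
qed

lemma last_layer:
  fixes u w :: "nat list"
  assumes dist: "distinct (u @ n # w)" and set: "set (u @ n # w) = {1..n}"
    and a231: "avoids_pattern (u @ n # w) [2, 3, 1]"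
    and a312: "avoids_pattern (u @ n # w) [3, 1, 2]"
  obtains m where "m < n" "set u = {1..m}" "n # w = rev [Suc m..<Suc n]"
proof -
  let ?v = "u @ n # w"
  have le: "x \<le> n" if "x \<in> set ?v" for x using that set by auto
  have less: "x < y" if x: "x \<in> set u" and y: "y \<in> set (n # w)" for x y
  proof (cases "y = n")
    case True
    then show ?thesis using x dist le[of x] by (cases "x = n") auto
  next
    case False
    then have "y \<in> set w" using y by simp
    then obtain k where k: "k < length w" "y = w ! k" by (auto simp: in_set_conv_nth)
    obtain i where i: "i < length u" "x = u ! i" using x by (auto simp: in_set_conv_nth)
    have "x \<noteq> y" "x < n" using x \<open>y \<in> set w\<close> dist le[of x] by (auto simp: le_less)
    \<comment> \<open>The triple \<open>x\<close>, \<open>n\<close>, \<open>y\<close> would be a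
      231.\<close>
    moreover have "\<not> (y < x \<and> x < n)"
      using a231[unfolded avoids_pattern_231_iff, rule_format, of i "length u" "length u + Suc k"] i k
      by (simp add: nth_append)
    ultimately show ?thesis by linarith
  qed
  have "w ! j < w ! i" if "i < j" "j < length w" for i j
  proof -
    \<comment> \<open>The triple \<open>n\<close>, \<open>w ! i\<close>, \<open>w ! j\<close> would
      be a 312.\<close>
    have "\<not> (w ! i < w ! j \<and> w ! j < n)"
      using a312[unfolded avoids_pattern_312_iff, rule_format,
          of "length u" "length u + Suc i" "length u + Suc j"] that
      by (simp add: nth_append)
    moreover have "w ! j < n"
      using dist le[of "w ! j"] that nth_mem[of j w] by (auto simp: le_less simp del: nth_mem)
    moreover have "w ! i \<noteq> w ! j" using dist that by (simp add: nth_eq_iff_index_eq)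
    ultimately show ?thesis by linarith
  qed
  moreover have "x < n" if "x \<in> set w" for x using dist le[of x] that by (auto simp: le_less)
  ultimately have decr: "sorted_wrt (>) (n # w)"
    by (simp add: sorted_wrt_iff_nth_less[of _ w])
  \<comment> \<open>All entries are at least 1, so this subtraction does not truncate and
    \<open>Suc m\<close> is the smallest entry from \<open>n\<close> on.\<close>
  define m where "m = Min (set (n # w)) - 1"
  have Min_mem: "Min (set (n # w)) \<in> set (n # w)" by (rule Min_in) auto
  moreover have "set (n # w) \<subseteq> {1..n}" using set by auto
  ultimately have "1 \<le> Min (set (n # w))" by (meson atLeastAtMost_iff subsetD)
  then have "Suc m = Min (set (n # w))" unfolding m_def by linarith
  then have min: "Suc m \<in> set (n # w)" "\<And>y. y \<in> set (n # w) \<Longrightarrow> Suc m \<le> y"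
    using Min_mem Min_le[of "set (n # w)"] by (metis, metis List.finite_set)
  have mem: "x \<in> set u \<or> x \<in> set (n # w) \<longleftrightarrow> 1 \<le> x \<and> x \<le> n" for x
    using set by (auto simp: set_eq_iff)
  \<comment> \<open>No number from \<open>Suc m\<close> to \<open>n\<close> can lie in
    \<open>u\<close>, whose entries are all below \<open>Suc m\<close>; hence the layer has no
    gaps.\<close>
  have setw: "set (n # w) = {Suc m..n}"
  proof (rule set_eqI)
    fix x show "x \<in> set (n # w) \<longleftrightarrow> x \<in> {Suc m..n}"
      using mem[of x] min less[of x "Suc m"] by force
  qed
  show thesis
  proof
    show "m < n" using min(2)[of n] by simp
    show "set u = {1..m}"
    proof (rule set_eqI)
      fix x show "x \<in> set u \<longleftrightarrow> x \<in> {1..m}"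
        using mem[of x, unfolded setw] less[OF _ min(1), of x] min(2)[of n]
        unfolding atLeastAtMost_iff by fastforce
    qed
    have "rev (n # w) = [Suc m..<Suc n]"
    proof (rule strict_sorted_equal)
      show "sorted_wrt (<) (rev (n # w))" unfolding sorted_wrt_rev by (rule decr)
      show "set (rev (n # w)) = set [Suc m..<Suc n]" unfolding set_rev setw by auto
    qed (simp del: upt_Suc)
    then show "n # w = rev [Suc m..<Suc n]" by (metis rev_rev_ident)
  qed
qed

section \<open>Linear extensions of the comb\<close>

text \<open>The contrapositive form of the order condition: \<open>sorted_wrt\<close> splits along
  \<open>u @ w\<close> into conditions inside \<open>u\<close>, inside \<open>w\<close> and
  across.\<close>

lemma is_linear_extension_iff_sorted_wrt:
  "is_linear_extension A r v \<longleftrightarrow>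
    distinct v \<and> set v = A \<and> sorted_wrt (\<lambda>x y. (y, x) \<notin> r) v"
  unfolding is_linear_extension_def sorted_wrt_iff_nth_less
  by (meson leD leI less_trans)

lemma comb_generators_mono: "m \<le> n \<Longrightarrow> comb_generators s m \<subseteq> comb_generators s n"
  by (auto simp: comb_generators_def)

text \<open>Every generator goes up in numerical order, so a chain that ends at
  \<open>x \<le> m\<close> stays within the numbers up to \<open>m\<close>, where the generators for
  \<open>m\<close> and \<open>n\<close> agree.\<close>

lemma comb_order_restrict:
  assumes "s \<ge> 1" "m \<le> n" "x \<le> m"
  shows "(y, x) \<in> comb_order s n \<longleftrightarrow> (y, x) \<in> comb_order s m"
proof
  assume "(y, x) \<in> comb_order s m"
  then show "(y, x) \<in> comb_order s n"
    using rtrancl_mono[OF comb_generators_mono[OF \<open>m \<le> n\<close>, of s]] \<open>m \<le> n\<close>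
    by (auto simp: comb_order_def)
next
  assume yx: "(y, x) \<in> comb_order s n"
  then have "(y, x) \<in> (comb_generators s n)\<^sup>*" by (simp add: comb_order_def)
  \<comment> \<open>The bound is kept inside the induction because the endpoint of the chain
    moves.\<close>
  then have "x \<le> m \<longrightarrow> (y, x) \<in> (comb_generators s m)\<^sup>*"
  proof (induction rule: rtrancl_induct)
    case (step a b)
    from step.hyps(2) have "a < b" using \<open>s \<ge> 1\<close> by (auto simp: comb_generators_def)
    moreover have "(a, b) \<in> comb_generators s m" if "b \<le> m"
      using step.hyps(2) that by (auto simp: comb_generators_def)
    ultimately show ?case using step.IH by (auto intro: rtrancl_into_rtrancl)
  qed simp
  moreover have "y \<le> x"
    using comb_generators_rtrancl_le[OF \<open>s \<ge> 1\<close>] yx by (auto simp: comb_order_def)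
  ultimately show "(y, x) \<in> comb_order s m"
    using yx \<open>x \<le> m\<close> by (auto simp: comb_order_def)
qed

text \<open>If the right side fails, the interval contains the spine relation from
  \<open>m + 1\<close> to \<open>m + 2\<close> or the tooth relation from \<open>n - s\<close> to
  \<open>n\<close>. If it holds, either the interval is a single point or no generator starts above
  \<open>m\<close>.\<close>

lemma comb_interval_antichain_iff:
  assumes "s \<ge> 1" "m < n"
  shows "(\<forall>y x. m < y \<longrightarrow> y < x \<longrightarrow> x \<le> n \<longrightarrow> (y, x) \<notin> comb_order s n) \<longleftrightarrow>
    Suc m = n \<or> n \<le> m + s \<and> s \<le> Suc m" (is "?L \<longleftrightarrow> ?R")
proof
  assume L: ?L
  show ?R
  proof (rule ccontr)
    assume "\<not> ?R"
    then consider "Suc m < n" "Suc m < s" | "m + s < n" using \<open>m < n\<close> by linarith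
    then show False
    proof cases
      case 1
      then have "(Suc m, Suc (Suc m)) \<in> comb_order s n"
        by (auto simp: comb_order_def comb_generators_def)
      then show False using L 1 by auto
    next
      case 2
      then have "(n - s, n) \<in> comb_generators s n"
        by (auto simp: comb_generators_def intro!: exI[of _ "n - s"])
      then have "(n - s, n) \<in> comb_order s n"
        using 2 by (auto simp: comb_order_def)
      then show False using L 2 \<open>s \<ge> 1\<close> by auto
    qed
  qed
next
  assume R: ?R
  show ?L
  proof (intro allI impI notI)
    fix y x assume yx: "m < y" "y < x" "x \<le> n" and "(y, x) \<in> comb_order s n"
    then have "(y, x) \<in> (comb_generators s n)\<^sup>*" by (simp add: comb_order_def)
    \<comment> \<open>The first step of the chain is enough: \<open>y \<ge> s\<close> rules out the
      spine and \<open>y + s > n\<close> rules out the teeth.\<close>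
    then obtain z where "(y, z) \<in> comb_generators s n"
      using \<open>y < x\<close> by (auto elim: converse_rtranclE)
    then show False using R yx by (auto simp: comb_generators_def)
  qed
qed

text \<open>Inside \<open>u\<close> the order for \<open>n\<close> restricts to that for
  \<open>m\<close>; across, the numbers increase, so nothing is violated; inside the decreasing
  layer every comparable pair would be listed the wrong way round, so it must be an
  antichain.\<close>

lemma append_layer_in_comb_extensions_iff:
  assumes "s \<ge> 1" "m < n" and u: "set u = {1..m}"
  shows "u @ rev [Suc m..<Suc n] \<in> comb_extensions_avoiding s n \<longleftrightarrow>
    u \<in> comb_extensions_avoiding s m \<and> (Suc m = n \<or> n \<le> m + s \<and> s \<le> Suc m)"
proof -
  let ?w = "rev [Suc m..<Suc n]"
  have less: "\<forall>x\<in>set u. \<forall>y\<in>set ?w. x < y" using u by auto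
  have decr: "sorted_wrt (>) ?w" by (simp add: sorted_wrt_rev del: upt_Suc)
  have sets: "set (u @ ?w) = {1..n}"
    unfolding set_append set_rev set_upt u using \<open>m < n\<close> by auto
  have dist: "distinct (u @ ?w) \<longleftrightarrow> distinct u"
    unfolding distinct_append set_rev set_upt u by auto
  let ?P = "\<lambda>n x y. (y, x) \<notin> comb_order s n"
  have "?P n x y \<longleftrightarrow> ?P m x y" if "x \<in> set u" for x y
    using that u comb_order_restrict[OF \<open>s \<ge> 1\<close>, of m n x y] \<open>m < n\<close> by simp
  then have "sorted_wrt (?P n) u \<longleftrightarrow> sorted_wrt (?P m) u"
    using sorted_wrt_mono_rel[of u "?P n" "?P m"] sorted_wrt_mono_rel[of u "?P m" "?P n"] by blast
  moreover have "\<forall>x\<in>set u. \<forall>y\<in>set ?w. ?P n x y"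
    using less comb_generators_rtrancl_le[OF \<open>s \<ge> 1\<close>]
    unfolding comb_order_def by (meson IntD1 leD)
  moreover have "sorted_wrt (?P n) ?w \<longleftrightarrow>
      (\<forall>y x. m < y \<longrightarrow> y < x \<longrightarrow> x \<le> n \<longrightarrow> (y, x) \<notin> comb_order s n)" (is "?A \<longleftrightarrow> ?B")
  proof
    assume ?B
    then show ?A by (intro sorted_wrt_mono_rel[OF _ decr]) auto
  next
    assume A: ?A
    show ?B
    proof (intro allI impI)
      fix y x assume yx: "m < y" "y < x" "x \<le> n"
      \<comment> \<open>Reversing the layer swaps the arguments and puts \<open>y\<close> at index
        \<open>y - Suc m\<close>.\<close>
      have "sorted_wrt (\<lambda>y x. (y, x) \<notin> comb_order s n) [Suc m..<Suc n]"
        using A by (simp add: sorted_wrt_rev del: upt_Suc)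
      then show "(y, x) \<notin> comb_order s n"
        using sorted_wrt_nth_less[of "\<lambda>y x. (y, x) \<notin> comb_order s n"
            "[Suc m..<Suc n]" "y - Suc m" "x - Suc m"] yx
        by (simp add: diff_less_mono del: upt_Suc)
    qed
  qed
  ultimately have "sorted_wrt (?P n) (u @ ?w) \<longleftrightarrow>
      sorted_wrt (?P m) u \<and> (Suc m = n \<or> n \<le> m + s \<and> s \<le> Suc m)"
    using comb_interval_antichain_iff[OF assms(1,2)] by (simp add: sorted_wrt_append del: upt_Suc)
  then show ?thesis
    unfolding comb_extensions_avoiding_def mem_Collect_eq is_linear_extension_iff_sorted_wrt
      avoids_pattern_append_layer[OF less decr] sets dist
    using u by blast
qed

section \<open>Counting\<close>

lemma num_comb_extensions_avoiding_0: "num_comb_extensions_avoiding s 0 = 1"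
proof -
  have "comb_extensions_avoiding s 0 = {[]}"
    by (auto simp: comb_extensions_avoiding_def is_linear_extension_def
        avoids_pattern_def contains_pattern_def)
  then show ?thesis by (simp add: num_comb_extensions_avoiding_def)
qed

text \<open>Removing the last layer is a bijection onto the pairs of an admissible \<open>m\<close>
  and an extension counted for \<open>m\<close>.\<close>

lemma num_comb_extensions_avoiding_eq_sum:
  assumes "s \<ge> 1" "n \<ge> 1"
  shows "num_comb_extensions_avoiding s n =
    (\<Sum>m | m < n \<and> (Suc m = n \<or> n \<le> m + s \<and> s \<le> Suc m). num_comb_extensions_avoiding s m)"
    (is "_ = sum _ ?M")
proof -
  let ?S = "comb_extensions_avoiding s"
  let ?f = "\<lambda>(m, u). u @ rev [Suc m..<Suc n]"
  have S: "distinct v \<and> set v = {1..m}" if "v \<in> ?S m" for v m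
    using that by (simp add: comb_extensions_avoiding_def is_linear_extension_def)
  have "inj_on ?f (Sigma ?M ?S)"
  proof (rule inj_onI, clarify)
    fix m u m' u'
    assume *: "m < n" "m' < n" "u \<in> ?S m" "u' \<in> ?S m'"
      and eq: "u @ rev [Suc m..<Suc n] = u' @ rev [Suc m'..<Suc n]"
    \<comment> \<open>The layer starts with \<open>n\<close>, which is not in \<open>u\<close>, so
      \<open>u\<close> is recovered as what precedes \<open>n\<close>; its length then gives
      \<open>m\<close>.\<close>
    have prefix: "takeWhile (\<lambda>x. x \<noteq> n) (u @ rev [Suc m..<Suc n]) = u"
      if "m < n" "u \<in> ?S m" for u m
      using that S[of u m] by (subst takeWhile_append2) auto
    have "u = u'" using prefix[of m u] prefix[of m' u'] * eq by metis
    moreover have "length u = m" "length u' = m'"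
      using S * distinct_card by fastforce+
    ultimately show "m = m' \<and> u = u'" by simp
  qed
  moreover have "?f ` Sigma ?M ?S = ?S n"
  proof (intro equalityI subsetI)
    fix v assume "v \<in> ?f ` Sigma ?M ?S"
    then show "v \<in> ?S n"
      using append_layer_in_comb_extensions_iff[OF \<open>s \<ge> 1\<close>, of _ n] S
      by (auto simp del: upt_Suc rev.simps)
  next
    fix v assume v: "v \<in> ?S n"
    then have "n \<in> set v" using S \<open>n \<ge> 1\<close> by auto
    then obtain u w where uw: "v = u @ n # w" by (auto dest: split_list)
    obtain m where m: "m < n" "set u = {1..m}" "n # w = rev [Suc m..<Suc n]"
      using last_layer[of u n w] v S[OF v] uw by (auto simp: comb_extensions_avoiding_def)
    then have "(m, u) \<in> Sigma ?M ?S"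
      using append_layer_in_comb_extensions_iff[OF \<open>s \<ge> 1\<close> m(1,2)] v uw by simp
    moreover have "v = ?f (m, u)" using uw m by simp
    ultimately show "v \<in> ?f ` Sigma ?M ?S" by blast
  qed
  ultimately have "card (?S n) = card (Sigma ?M ?S)"
    using card_image[of ?f "Sigma ?M ?S"] by simp
  then show ?thesis
    unfolding num_comb_extensions_avoiding_def
    by (simp add: finite_comb_extensions_avoiding)
qed

lemma num_comb_extensions_avoiding_short:
  assumes "s \<ge> 1" "n \<le> s"
  shows "num_comb_extensions_avoiding s n = 1"
  using assms(2)
proof (induction n)
  case 0
  show ?case by (rule num_comb_extensions_avoiding_0)
next
  case (Suc n)
  \<comment> \<open>Since \<open>Suc n \<le> s\<close>, the alternative with
    \<open>s \<le> Suc m\<close> also forces \<open>m = n\<close>: the comb is a chain and all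
    layers are singletons.\<close>
  then have "{m. m < Suc n \<and> (Suc m = Suc n \<or> Suc n \<le> m + s \<and> s \<le> Suc m)} = {n}" by auto
  then show ?case
    using num_comb_extensions_avoiding_eq_sum[of s "Suc n"] assms(1) Suc by simp
qed

text \<open>For \<open>n \<ge> s\<close> the choice \<open>m = n - 1\<close> satisfies the two lower
  bounds of the other alternative, so the admissible \<open>m\<close> form one interval.\<close>

lemma num_comb_extensions_avoiding_eq_sum_window:
  assumes "s \<ge> 1" "n \<ge> s"
  shows "num_comb_extensions_avoiding s n =
    (\<Sum>m = max (n - s) (s - 1)..<n. num_comb_extensions_avoiding s m)"
proof -
  have "{m. m < n \<and> (Suc m = n \<or> n \<le> m + s \<and> s \<le> Suc m)} = {max (n - s) (s - 1)..<n}"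
    using assms by auto
  then show ?thesis using num_comb_extensions_avoiding_eq_sum[of s n] assms by simp
qed

text \<open>While \<open>n < 2 * s\<close> the window keeps its left end \<open>s - 1\<close>.
  Passing to the next sum adds the term \<open>f n\<close> to a sum equal to \<open>f n\<close>, so
  the value doubles, starting from 1 at \<open>n = s\<close>.\<close>

lemma num_comb_extensions_avoiding_medium:
  assumes "s \<ge> 1" "s \<le> n" "n < 2 * s"
  shows "num_comb_extensions_avoiding s n = 2 ^ (n - s)"
  using assms(2,3)
proof (induction n rule: nat_induct_at_least)
  case base
  then show ?case using num_comb_extensions_avoiding_short[of s s] assms(1) by simp
next
  case (Suc n)
  let ?f = "num_comb_extensions_avoiding s"
  have start: "max (Suc n - s) (s - 1) = s - 1" "max (n - s) (s - 1) = s - 1"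
    using Suc by auto
  have "?f (Suc n) = (\<Sum>m = s - 1..<Suc n. ?f m)"
    using num_comb_extensions_avoiding_eq_sum_window[of s "Suc n"] Suc assms(1)
    unfolding start by simp
  also have "\<dots> = (\<Sum>m = s - 1..<n. ?f m) + ?f n"
    using Suc by simp
  also have "(\<Sum>m = s - 1..<n. ?f m) = ?f n"
    using num_comb_extensions_avoiding_eq_sum_window[of s n] Suc assms(1)
    unfolding start by simp
  finally show ?case using Suc by (simp add: Suc_diff_le)
qed

text \<open>The window now has width \<open>s\<close> and slides: from \<open>n - 1\<close> to
  \<open>n\<close> it gains the term at \<open>n - 1\<close> and loses the one at
  \<open>n - s - 1\<close>. The additive form avoids truncated subtraction.\<close>

lemma num_comb_extensions_avoiding_long:
  assumes "s \<ge> 1" "n \<ge> 2 * s"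
  shows "num_comb_extensions_avoiding s n + num_comb_extensions_avoiding s (n - s - 1) =
    2 * num_comb_extensions_avoiding s (n - 1)"
proof -
  let ?f = "num_comb_extensions_avoiding s"
  \<comment> \<open>At \<open>n = 2 * s\<close> the second maximum is a tie,
    \<open>n - s - 1 = s - 1\<close>, so the window for \<open>n - 1\<close> already has full
    width.\<close>
  have start: "max (n - s) (s - 1) = n - s" "max (n - 1 - s) (s - 1) = n - s - 1"
    using assms by auto
  have "?f n = (\<Sum>m = n - s..<n. ?f m)"
    using num_comb_extensions_avoiding_eq_sum_window[of s n] assms unfolding start by simp
  also have "\<dots> = (\<Sum>m = n - s..<n - 1. ?f m) + ?f (n - 1)"
    using assms sum.atLeastLessThan_Suc[of "n - s" "n - 1" ?f] by simp
  finally have n: "?f n = (\<Sum>m = n - s..<n - 1. ?f m) + ?f (n - 1)" .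
  have "?f (n - 1) = (\<Sum>m = n - s - 1..<n - 1. ?f m)"
    using num_comb_extensions_avoiding_eq_sum_window[of s "n - 1"] assms
    unfolding start by simp
  also have "\<dots> = ?f (n - s - 1) + (\<Sum>m = n - s..<n - 1. ?f m)"
    using assms sum.atLeast_Suc_lessThan[of "n - s - 1" "n - 1" ?f] by (simp add: Suc_diff_Suc)
  finally show ?thesis using n by simp
qed

theorem theorem14:
  fixes s n :: nat
  assumes "s \<ge> 1"
  shows "int (num_comb_extensions_avoiding s n) =
    (if n \<le> s then 1
     else if n < 2 * s then 2 ^ (n - s)
     else 2 * int (num_comb_extensions_avoiding s (n - 1))
            - int (num_comb_extensions_avoiding s (n - s - 1)))"
  using num_comb_extensions_avoiding_short[OF assms, of n]
    num_comb_extensions_avoiding_medium[OF assms, of n]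
    num_comb_extensions_avoiding_long[OF assms, of n]
  by auto

end
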